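(* Write the characteristic polynomial of $P_K$ as $\Phi(P_K,\lambda)=\sum_{i=0}^n a_i^K\lambda^i$. Then $K^*$ is a critical point of the map $\mathbb{R}^{n\times m}\to\mathbb{R}$, $K\mapsto|a_i^K|$, for all $i=1,\dots,n$, and it is a minimizer of this map for even $i$: $$K^*=\arg\min_{K\in\mathbb{R}^{n\times m}}|a_i^K|\quad\text{whenever } i \text{ is even}.$$
   Context: Let $P\in\mathbb{R}^{n\times n}$ (prior covariance) and $R\in\mathbb{R}^{m\times m}$ (likelihood covariance) be symmetric and positive definite, and let $H\in\mathbb{R}^{m\times n}$ (measurement operator). The Kalman gain is $K^*=PH^\top(HPH^\top+R)^{-1}\in\mathbb{R}^{n\times m}$. For $K\in\mathbb{R}^{n\times m}$ set $P_K=(I-KH)P(I-KH)^\top+KRK^\top$, where $I$ is the $n\times n$ identity matrix; $P_K$ is symmetric and positive definite, and $P_{K^*}$ is the posterior covariance. Let $\Phi(P_K,\lambda):=\det(\lambda I-P_K)$ be the characteristic polynomial of $P_K$. A critical point of a real-valued function of $K$ is a point where its derivative with respect to $K$ exists and vanishes. The notation $K^*=\arg\min_K f(K)$ means that $K^*$ is a global minimizer: $f(K^* )\le f(K)$ for all $K\in\mathbb{R}^{n\times m}$. *)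

theory Defs
  imports "HOL-Analysis.Analysis" "HOL-Computational_Algebra.Polynomial"
begin

definition sym_pos_def :: "real^'k^'k \<Rightarrow> bool" where
  "sym_pos_def A \<longleftrightarrow> transpose A = A \<and> (\<forall>x. x \<noteq> 0 \<longrightarrow> 0 < x \<bullet> (A *v x))"

definition kalman_gain :: "real^'n^'n \<Rightarrow> real^'m^'m \<Rightarrow> real^'n^'m \<Rightarrow> real^'m^'n" where
  "kalman_gain P R H = P ** transpose H ** matrix_inv (H ** P ** transpose H + R)"

definition gain_cov ::
    "real^'n^'n \<Rightarrow> real^'m^'m \<Rightarrow> real^'n^'m \<Rightarrow> real^'m^'n \<Rightarrow> real^'n^'n" where
  "gain_cov P R H K =
     (mat 1 - K ** H) ** P ** transpose (mat 1 - K ** H) + K ** R ** transpose K"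

text \<open>The determinant of \<open>\<lambda> I - A\<close>, taken over the polynomial ring, where
  \<open>[:0, 1:]\<close> is the indeterminate \<open>\<lambda>\<close>. Its value at a real number is given by the
  lemma below.\<close>

definition charpoly :: "real^'k^'k \<Rightarrow> real poly" where
  "charpoly A = det (mat [:0, 1:] - (\<chi> i j. [:A $ i $ j:]))"

lemma poly_charpoly: "poly (charpoly A) l = det (l *\<^sub>R mat 1 - A)"
  unfolding charpoly_def det_def
  by (auto simp: poly_sum poly_prod mat_def sign_def intro!: sum.cong prod.cong)

definition critical_point :: "('a::real_normed_vector \<Rightarrow> real) \<Rightarrow> 'a \<Rightarrow> bool" where
  "critical_point f x \<longleftrightarrow> (f has_derivative (\<lambda>_. 0)) (at x)"

end

theory Submission
  imports Defs
begin

text \<open>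
  Up to the sign \<open>(-1)^(n - i)\<close>, the coefficient of \<open>\<lambda>^i\<close> in \<open>det (\<lambda> I - A)\<close> is the sum of the
  principal minors of \<open>A\<close> of size \<open>n - i\<close>. For a positive definite matrix all these minors are
  positive, so the absolute value of the coefficient \<^emph>\<open>is\<close> this sum
  (\<open>coeff_charpoly\<close>, \<open>abs_coeff_charpoly\<close>).

  Adding a positive semidefinite matrix to a positive definite one does not decrease the determinant
  (\<open>det_add_psd_ge\<close>), and a principal submatrix of a positive (semi)definite matrix is again
  positive (semi)definite. Hence every principal minor, and with it the absolute value of every
  coefficient, is monotone for the Loewner order. Completing the square in \<open>K\<close> gives
  \<open>P\<^sub>K = P\<^sub>K\<^sub>* + (K - K\<^sub>*) S (K - K\<^sub>*)\<^sup>T\<close> with \<open>S = H P H\<^sup>T + R\<close> positive definite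
  (\<open>gain_cov_complete_square\<close>), so \<open>P\<^sub>K\<^sub>*\<close> is the least element of this order among all \<open>P\<^sub>K\<close>.

  Thus the Kalman gain minimizes \<open>\<bar>a\<^sub>i\<bar>\<close> for every \<open>i\<close>, of either parity. As a sum of minors this
  function is a polynomial in the entries of \<open>K\<close>, hence differentiable, and its derivative
  vanishes at the global minimizer \<open>K\<^sub>*\<close>.
\<close>

section \<open>Positive semidefinite matrices\<close>

definition sym_pos_semidef :: "real^'k^'k \<Rightarrow> bool" where
  "sym_pos_semidef A \<longleftrightarrow> transpose A = A \<and> (\<forall>x. 0 \<le> x \<bullet> (A *v x))"

lemma sym_pos_def_imp_semidef: "sym_pos_def A \<Longrightarrow> sym_pos_semidef A"
  unfolding sym_pos_def_def sym_pos_semidef_def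
  by (metis inner_zero_left less_imp_le order_refl)

lemma transpose_add: "transpose (A + B) = transpose A + transpose (B :: real^'a^'b)"
  by (simp add: transpose_def vec_eq_iff)

lemma transpose_diff: "transpose (A - B) = transpose A - transpose (B :: real^'a^'b)"
  by (simp add: transpose_def vec_eq_iff)

lemma matrix_add_rdistrib: "(A + B) ** C = A ** C + B ** (C :: real^'c^'b)"
  by (simp add: matrix_matrix_mult_def vec_eq_iff distrib_right sum.distrib)

lemma matrix_diff_ldistrib: "A ** (B - C) = A ** B - A ** (C :: real^'c^'b)"
  by (simp add: matrix_matrix_mult_def vec_eq_iff right_diff_distrib sum_subtractf)

lemma matrix_diff_rdistrib: "(A - B) ** C = A ** C - B ** (C :: real^'c^'b)"
  by (simp add: matrix_matrix_mult_def vec_eq_iff left_diff_distrib sum_subtractf)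

lemma sym_pos_def_add:
  "sym_pos_def A \<Longrightarrow> sym_pos_semidef B \<Longrightarrow> sym_pos_def (A + B)"
  unfolding sym_pos_def_def sym_pos_semidef_def
  by (auto simp: transpose_add matrix_vector_mult_add_rdistrib inner_add_right
           intro!: add_pos_nonneg)

lemma inner_symmetric_matrix:
  fixes A :: "real^'k^'k"
  assumes "transpose A = A"
  shows "x \<bullet> (A *v y) = (A *v x) \<bullet> y"
  by (metis assms dot_lmul_matrix transpose_matrix_vector)

lemma inner_congruence:
  fixes C :: "real^'m^'n" and A :: "real^'m^'m"
  shows "x \<bullet> ((C ** A ** transpose C) *v x) = (transpose C *v x) \<bullet> (A *v (transpose C *v x))"
  by (metis dot_lmul_matrix matrix_vector_mul_assoc transpose_matrix_vector)

lemma sym_pos_semidef_congruence: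
  fixes C :: "real^'m^'n" and A :: "real^'m^'m"
  assumes "sym_pos_semidef A"
  shows "sym_pos_semidef (C ** A ** transpose C)"
  using assms unfolding sym_pos_semidef_def inner_congruence
  by (simp add: matrix_transpose_mul matrix_mul_assoc)

lemma sym_pos_def_invertible:
  assumes "sym_pos_def (A :: real^'k^'k)"
  shows "invertible A"
proof -
  have "\<forall>x. A *v x = 0 \<longrightarrow> x = 0"
    using assms unfolding sym_pos_def_def by (metis inner_zero_right less_irrefl)
  then show ?thesis
    by (simp add: invertible_left_inverse matrix_left_invertible_ker)
qed

text \<open>The segment from the identity to \<open>A\<close> consists of positive definite, hence invertible,
  matrices, so the determinant keeps the sign that it has at the identity.\<close>

lemma sym_pos_def_det_pos:
  assumes A: "sym_pos_def (A :: real^'k^'k)"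
  shows "0 < det A"
proof (rule ccontr)
  assume neg: "\<not> 0 < det A"
  define M where "M = (\<lambda>s::real. (1 - s) *\<^sub>R mat 1 + s *\<^sub>R A)"
  have "continuous_on {0..1} (\<lambda>s. det (M s))"
    unfolding det_def M_def by (auto intro!: continuous_intros)
  moreover have "det (M 0) = 1" "det (M 1) = det A"
    by (simp_all add: M_def)
  ultimately obtain s where s: "0 \<le> s" "s \<le> 1" "det (M s) = 0"
    using IVT2'[of "\<lambda>s. det (M s)" 1 0 0] neg by auto
  have "sym_pos_def (M s)"
    unfolding sym_pos_def_def
  proof (intro conjI allI impI)
    show "transpose (M s) = M s"
      using A by (simp add: M_def transpose_add transpose_scalar sym_pos_def_def)
    fix x :: "real^'k" assume x: "x \<noteq> 0"
    have "x \<bullet> (M s *v x) = (1 - s) * (x \<bullet> x) + s * (x \<bullet> (A *v x))"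
      by (simp add: M_def matrix_vector_mult_add_rdistrib inner_add_right
          flip: scaleR_matrix_vector_assoc)
    moreover have "0 < x \<bullet> x" "0 < x \<bullet> (A *v x)"
      using A x by (auto simp: sym_pos_def_def)
    moreover have "s = 0 \<or> 0 < s" using s by auto
    ultimately show "0 < x \<bullet> (M s *v x)"
      using s by (elim disjE) (simp_all add: add_nonneg_pos)
  qed
  then show False
    using s sym_pos_def_invertible invertible_det_nz by blast
qed

section \<open>Rank-one updates of the determinant\<close>

definition outer_product :: "real^'a \<Rightarrow> real^'b \<Rightarrow> real^'b^'a" where
  "outer_product u v = (\<chi> i j. u $ i * v $ j)"

lemma outer_product_mult_vector: "outer_product u v *v x = (v \<bullet> x) *\<^sub>R u"
  by (simp add: outer_product_def matrix_vector_mult_def vec_eq_iff inner_vec_def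
      sum_distrib_left sum_distrib_right mult_ac)

lemma matrix_mult_outer_product: "A ** outer_product u v = outer_product (A *v u) v"
  by (simp add: outer_product_def matrix_vector_mult_def matrix_matrix_mult_def vec_eq_iff
      sum_distrib_left sum_distrib_right mult_ac)

lemma outer_product_mult_matrix: "outer_product u v ** A = outer_product u (v v* A)"
  by (simp add: outer_product_def vector_matrix_mult_def matrix_matrix_mult_def vec_eq_iff
      sum_distrib_left mult_ac)

lemma sym_pos_semidef_outer_product: "sym_pos_semidef (outer_product v v)"
  by (simp add: sym_pos_semidef_def outer_product_mult_vector inner_commute)
     (simp add: outer_product_def transpose_def vec_eq_iff mult.commute)

lemma det_id_add_column:
  fixes u :: "real^'k"
  shows "det (mat 1 + outer_product u (axis k 1)) = 1 + u $ k"
proof -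
  have "mat 1 + outer_product u (axis k 1) =
      (\<chi> i j. if j = k then (axis k 1 + u) $ i else mat 1 $ i $ j)"
    by (auto simp: vec_eq_iff outer_product_def mat_def axis_def)
  then show ?thesis
    using cramer_lemma[of k "mat 1" "axis k 1 + u"] by (simp only: matrix_vector_mul_lid) simp
qed

text \<open>Let \<open>T\<close> be the identity with row \<open>k\<close> replaced by \<open>v\<close>. Conjugating by \<open>T\<close> turns the
  covector \<open>v\<close> into a coordinate covector, which leaves a matrix differing from the identity in a
  single column.\<close>

lemma det_id_add_outer_product:
  fixes u v :: "real^'k"
  shows "det (mat 1 + outer_product u v) = 1 + v \<bullet> u"
proof (cases "v = 0")
  case True
  then show ?thesis by (simp add: outer_product_def zero_vec_def[symmetric])
next
  case False
  then obtain k where k: "v $ k \<noteq> 0" by (auto simp: vec_eq_iff)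
  define T :: "real^'k^'k" where "T = (\<chi> i j. if i = k then v $ j else mat 1 $ i $ j)"
  have "transpose T = (\<chi> i j. if j = k then v $ i else mat 1 $ i $ j)"
    by (auto simp: T_def transpose_def vec_eq_iff mat_def)
  then have "det (transpose T) = v $ k"
    using cramer_lemma[of k "mat 1" v] by (simp only: matrix_vector_mul_lid) simp
  then have T: "det T \<noteq> 0"
    using k by (simp add: det_transpose)
  have row: "axis k 1 v* T = v"
    by (simp add: T_def vector_matrix_mult_def vec_eq_iff axis_def if_distrib[of "\<lambda>x. _ * x"] cong: if_cong)
  have Tu: "(T *v u) $ k = v \<bullet> u"
    by (simp add: T_def matrix_vector_mult_def inner_vec_def)
  have "T ** (mat 1 + outer_product u v) = (mat 1 + outer_product (T *v u) (axis k 1)) ** T"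
    by (simp add: matrix_add_ldistrib matrix_add_rdistrib matrix_mult_outer_product
        outer_product_mult_matrix row)
  then have "det T * det (mat 1 + outer_product u v) = (1 + v \<bullet> u) * det T"
    by (metis Tu det_id_add_column det_mul)
  with T show ?thesis by simp
qed

lemma det_add_outer_product_ge:
  fixes A :: "real^'k^'k"
  assumes A: "sym_pos_def A"
  shows "det A \<le> det (A + outer_product v v)"
proof -
  obtain B where B: "A ** B = mat 1"
    using sym_pos_def_invertible[OF A] by (auto simp: invertible_def)
  define w where "w = B *v v"
  have v: "v = A *v w"
    by (simp add: w_def matrix_vector_mul_assoc B)
  have "A + outer_product v v = A ** (mat 1 + outer_product w v)"
    by (simp add: matrix_add_ldistrib matrix_mult_outer_product flip: v)
  then have "det (A + outer_product v v) = det A * (1 + v \<bullet> w)"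
    by (simp add: det_mul det_id_add_outer_product)
  moreover have "0 \<le> v \<bullet> w"
    using sym_pos_def_imp_semidef[OF A] by (simp add: v inner_commute sym_pos_semidef_def)
  ultimately show ?thesis
    using sym_pos_def_det_pos[OF A] by (simp add: algebra_simps)
qed

section \<open>Monotonicity of the determinant\<close>

lemma axis_inner_matrix: "axis i 1 \<bullet> (A *v axis j 1) = (A :: real^'k^'k) $ i $ j"
  by (simp add: matrix_vector_mult_basis column_def inner_axis')

lemma sym_pos_semidef_diag_nonneg: "sym_pos_semidef A \<Longrightarrow> 0 \<le> A $ i $ i"
  unfolding sym_pos_semidef_def by (metis axis_inner_matrix)

lemma symmetric_entry: "transpose A = A \<Longrightarrow> A $ i $ j = A $ j $ i"
  by (metis transpose_def vec_lambda_beta)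

text \<open>The symmetric Gaussian elimination step: subtracting a multiple of the outer square of row
  \<open>i\<close> clears row and column \<open>i\<close>. The remainder is semidefinite because its quadratic form at
  \<open>x\<close> is the minimum over \<open>t\<close> of the form of \<open>B\<close> at \<open>x - t e\<^sub>i\<close>.\<close>

lemma sym_pos_semidef_eliminate:
  fixes B :: "real^'k^'k"
  assumes B: "sym_pos_semidef B" and i: "0 < B $ i $ i"
  defines "v \<equiv> (1 / sqrt (B $ i $ i)) *\<^sub>R row i B"
  shows "sym_pos_semidef (B - outer_product v v)"
  unfolding sym_pos_semidef_def
proof (intro conjI allI)
  have sym: "transpose B = B" using B by (simp add: sym_pos_semidef_def)
  then show "transpose (B - outer_product v v) = B - outer_product v v"
    using sym_pos_semidef_outer_product[of v] by (simp add: transpose_diff sym_pos_semidef_def)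
  fix x :: "real^'k"
  define b where "b = (B *v x) $ i"
  define t where "t = b / B $ i $ i"
  have row: "row i B \<bullet> x = b"
    by (simp add: b_def matrix_vector_mul_component row_def)
  have ib: "axis i 1 \<bullet> (B *v x) = b"
    by (simp add: b_def inner_axis')
  then have bi: "x \<bullet> (B *v axis i 1) = b"
    by (metis inner_symmetric_matrix[OF sym] inner_commute)
  have "0 \<le> (x - t *\<^sub>R axis i 1) \<bullet> (B *v (x - t *\<^sub>R axis i 1))"
    using B by (simp add: sym_pos_semidef_def)
  also have "\<dots> = x \<bullet> (B *v x) - 2 * t * b + t * t * B $ i $ i"
    by (simp add: matrix_vector_mult_diff_distrib matrix_vector_mult_scaleR inner_diff_left
        inner_diff_right ib bi axis_inner_matrix algebra_simps)
  also have "\<dots> = x \<bullet> (B *v x) - (v \<bullet> x) * (v \<bullet> x)"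
    using i by (simp add: t_def v_def row field_simps)
  also have "\<dots> = x \<bullet> ((B - outer_product v v) *v x)"
    by (simp add: matrix_vector_mult_diff_rdistrib outer_product_mult_vector inner_diff_right
        inner_commute)
  finally show "0 \<le> x \<bullet> ((B - outer_product v v) *v x)" .
qed

lemma sym_pos_semidef_diag_zero:
  fixes B :: "real^'k^'k"
  assumes B: "sym_pos_semidef B" and diag: "\<And>i. B $ i $ i = 0"
  shows "B = 0"
proof -
  have "B $ i $ j = 0" for i j
  proof -
    have sym: "transpose B = B" using B by (simp add: sym_pos_semidef_def)
    \<comment> \<open>With a zero diagonal the quadratic form is indefinite on the span of two axes unless the
      entry joining them is zero.\<close>
    have "0 \<le> (axis i 1 + c *\<^sub>R axis j 1) \<bullet> (B *v (axis i 1 + c *\<^sub>R axis j 1))" for c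
      using B by (simp add: sym_pos_semidef_def)
    then have "0 \<le> 2 * c * B $ i $ j" for c
      using diag symmetric_entry[OF sym, of j i]
      by (simp add: matrix_vector_right_distrib matrix_vector_mult_scaleR inner_add_left
          inner_add_right axis_inner_matrix)
    from this[of 1] this[of "-1"] show ?thesis by simp
  qed
  then show ?thesis by (simp add: vec_eq_iff)
qed

text \<open>Peel off rank-one summands of \<open>B\<close> by elimination and absorb them into \<open>A\<close>; each step makes
  one more diagonal entry of \<open>B\<close> vanish, and never revives one that has vanished.\<close>

theorem det_add_psd_ge:
  fixes A B :: "real^'k^'k"
  assumes "sym_pos_def A" and "sym_pos_semidef B"
  shows "det A \<le> det (A + B)"
  using assms
proof (induction "card {i. B $ i $ i \<noteq> 0}" arbitrary: A B rule: less_induct)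
  case less
  show ?case
  proof (cases "\<exists>i. B $ i $ i \<noteq> 0")
    case False
    then show ?thesis using sym_pos_semidef_diag_zero[OF less.prems(2)] by simp
  next
    case True
    then obtain i where i: "0 < B $ i $ i"
      using sym_pos_semidef_diag_nonneg[OF less.prems(2)] by (metis order_le_less)
    define v where "v = (1 / sqrt (B $ i $ i)) *\<^sub>R row i B"
    define B' where "B' = B - outer_product v v"
    have psd: "sym_pos_semidef B'"
      unfolding B'_def v_def by (rule sym_pos_semidef_eliminate[OF less.prems(2) i])
    have diag: "B' $ j $ j = B $ j $ j - (v $ j)\<^sup>2" for j
      by (simp add: B'_def outer_product_def power2_eq_square)
    have cleared: "B' $ i $ i = 0"
      using i by (simp add: diag v_def row_def power_divide power2_eq_square)
    have kept: "B' $ j $ j = 0" if "B $ j $ j = 0" for j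
      using sym_pos_semidef_diag_nonneg[OF psd, of j] diag[of j] that by simp
    have "{j. B' $ j $ j \<noteq> 0} \<subset> {j. B $ j $ j \<noteq> 0}"
    proof
      show "{j. B' $ j $ j \<noteq> 0} \<subseteq> {j. B $ j $ j \<noteq> 0}"
        using kept by blast
      have "i \<in> {j. B $ j $ j \<noteq> 0} - {j. B' $ j $ j \<noteq> 0}"
        using i cleared by simp
      then show "{j. B' $ j $ j \<noteq> 0} \<noteq> {j. B $ j $ j \<noteq> 0}" by blast
    qed
    then have smaller: "card {j. B' $ j $ j \<noteq> 0} < card {j. B $ j $ j \<noteq> 0}"
      by (intro psubset_card_mono) auto
    have "det A \<le> det (A + outer_product v v)"
      by (rule det_add_outer_product_ge[OF less.prems(1)])
    also have "\<dots> \<le> det (A + outer_product v v + B')"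
      by (rule less.hyps[OF smaller
            sym_pos_def_add[OF less.prems(1) sym_pos_semidef_outer_product] psd])
    also have "A + outer_product v v + B' = A + B"
      by (simp add: B'_def)
    finally show ?thesis .
  qed
qed

section \<open>Principal minors\<close>

definition principal_submatrix :: "'k set \<Rightarrow> real^'k^'k \<Rightarrow> real^'k^'k" where
  "principal_submatrix T A = (\<chi> i j. if i \<in> T \<and> j \<in> T then A $ i $ j else 0)"

text \<open>The submatrix is completed by ones on the diagonal outside \<open>T\<close>, which keeps its determinant
  and avoids a change of the index type.\<close>

definition principal_minor :: "'k set \<Rightarrow> real^'k^'k \<Rightarrow> real" where
  "principal_minor T A = det (principal_submatrix T A + principal_submatrix (- T) (mat 1))"

lemma principal_submatrix_add:
  "principal_submatrix T (A + B) = principal_submatrix T A + principal_submatrix T B"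
  by (simp add: principal_submatrix_def vec_eq_iff)

lemma transpose_principal_submatrix:
  "transpose (principal_submatrix T A) = principal_submatrix T (transpose A)"
  by (auto simp: principal_submatrix_def transpose_def vec_eq_iff)

lemma inner_principal_submatrix:
  fixes x :: "real^'k"
  defines "y T \<equiv> (\<chi> i. if i \<in> T then x $ i else 0)"
  shows "x \<bullet> (principal_submatrix T A *v x) = y T \<bullet> (A *v y T)"
  unfolding y_def principal_submatrix_def matrix_vector_mult_def inner_vec_def
  by (auto intro!: sum.cong simp: if_distrib cong: if_cong)

lemma sym_pos_semidef_principal_submatrix:
  "sym_pos_semidef A \<Longrightarrow> sym_pos_semidef (principal_submatrix T A)"
  by (simp add: sym_pos_semidef_def transpose_principal_submatrix inner_principal_submatrix)

lemma sym_pos_def_padded_submatrix: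
  fixes A :: "real^'k^'k"
  assumes A: "sym_pos_def A"
  shows "sym_pos_def (principal_submatrix T A + principal_submatrix (- T) (mat 1))"
    (is "sym_pos_def (?A + ?I)")
  unfolding sym_pos_def_def
proof (intro conjI allI impI)
  show "transpose (?A + ?I) = ?A + ?I"
    using A by (simp add: transpose_add transpose_principal_submatrix sym_pos_def_def)
  fix x :: "real^'k" assume "x \<noteq> 0"
  define y where "y T = (\<chi> i. if i \<in> T then x $ i else 0)" for T
  have eq: "x \<bullet> ((?A + ?I) *v x) = y T \<bullet> (A *v y T) + y (- T) \<bullet> y (- T)"
    by (simp add: matrix_vector_mult_add_rdistrib inner_add_right inner_principal_submatrix y_def)
  have "x = y T + y (- T)" by (simp add: y_def vec_eq_iff)
  with \<open>x \<noteq> 0\<close> have "y T \<noteq> 0 \<or> y (- T) \<noteq> 0" by auto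
  then show "0 < x \<bullet> ((?A + ?I) *v x)"
  proof
    assume "y T \<noteq> 0"
    then have "0 < y T \<bullet> (A *v y T)" using A by (simp add: sym_pos_def_def)
    then show ?thesis unfolding eq by (simp add: add_pos_nonneg)
  next
    assume "y (- T) \<noteq> 0"
    moreover have "0 \<le> y T \<bullet> (A *v y T)"
      using sym_pos_def_imp_semidef[OF A] by (simp add: sym_pos_semidef_def)
    ultimately show ?thesis unfolding eq by (simp add: add_nonneg_pos)
  qed
qed

lemma principal_minor_pos: "sym_pos_def A \<Longrightarrow> 0 < principal_minor T A"
  unfolding principal_minor_def by (intro sym_pos_def_det_pos sym_pos_def_padded_submatrix)

lemma principal_minor_mono:
  assumes "sym_pos_def A" and "sym_pos_semidef B"
  shows "principal_minor T A \<le> principal_minor T (A + B)"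
  using det_add_psd_ge[OF sym_pos_def_padded_submatrix sym_pos_semidef_principal_submatrix,
      OF assms, of T T]
  by (simp add: principal_minor_def principal_submatrix_add add_ac)

section \<open>Coefficients of the characteristic polynomial\<close>

text \<open>A term of the Leibniz formula for the diagonal matrix \<open>l I\<close> in the rows outside \<open>T\<close>
  and \<open>A\<close> in the rows of \<open>T\<close> vanishes unless the permutation fixes every point outside \<open>T\<close>; such
  a permutation maps \<open>T\<close> to itself, so that only entries of the principal submatrix occur.\<close>

lemma leibniz_term_principal_minor:
  fixes A :: "real^'k^'k" and T :: "'k set"
  assumes p: "p permutes UNIV"
  shows "(\<Prod>i\<in>T. A $ i $ p i) * (\<Prod>i\<in>-T. (l *\<^sub>R mat 1 :: real^'k^'k) $ i $ p i) =
    l ^ card (- T) *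
      (\<Prod>i\<in>UNIV. (principal_submatrix T A + principal_submatrix (- T) (mat 1)) $ i $ p i)"
    (is "_ = _ * (\<Prod>i\<in>UNIV. ?M $ i $ p i)")
proof (cases "\<forall>i\<in>-T. p i = i")
  case True
  have T: "p i \<in> T" if "i \<in> T" for i
    using True p that by (metis ComplI permutes_inv_eq)
  have "(\<Prod>i\<in>UNIV. ?M $ i $ p i) = (\<Prod>i\<in>T. ?M $ i $ p i) * (\<Prod>i\<in>-T. ?M $ i $ p i)"
    by (subst prod.union_disjoint[symmetric]) (auto simp: Compl_partition)
  also have "(\<Prod>i\<in>T. ?M $ i $ p i) = (\<Prod>i\<in>T. A $ i $ p i)"
    by (intro prod.cong) (auto simp: principal_submatrix_def T)
  also have "(\<Prod>i\<in>-T. ?M $ i $ p i) = 1"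
    by (intro prod.neutral) (use True in \<open>auto simp: principal_submatrix_def mat_def\<close>)
  finally have "(\<Prod>i\<in>UNIV. ?M $ i $ p i) = (\<Prod>i\<in>T. A $ i $ p i)" by simp
  moreover have "(\<Prod>i\<in>-T. (l *\<^sub>R mat 1 :: real^'k^'k) $ i $ p i) = (\<Prod>i\<in>-T. l)"
    by (intro prod.cong) (use True in \<open>auto simp: mat_def\<close>)
  ultimately show ?thesis by simp
next
  case False
  then obtain i where i: "i \<notin> T" "p i \<noteq> i" by auto
  have "(\<Prod>i\<in>-T. (l *\<^sub>R mat 1 :: real^'k^'k) $ i $ p i) = 0"
    by (rule prod_zero) (use i in \<open>auto simp: mat_def intro!: bexI[of _ i]\<close>)
  moreover have "(\<Prod>i\<in>UNIV. ?M $ i $ p i) = 0"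
    by (rule prod_zero)
       (use i in \<open>auto simp: mat_def principal_submatrix_def intro!: exI[of _ i]\<close>)
  ultimately show ?thesis by (simp only: mult_zero_right)
qed

text \<open>Expand each product in the Leibniz formula by the set \<open>T\<close> of rows in which the factor is
  taken from \<open>A\<close> rather than from \<open>l I\<close>.\<close>

lemma det_scaled_id_diff:
  fixes A :: "real^'k^'k"
  shows "det (l *\<^sub>R mat 1 - A) =
    (\<Sum>T\<in>UNIV. (-1) ^ card T * principal_minor T A * l ^ card (- T))"
proof -
  let ?P = "{p. p permutes (UNIV :: 'k set)}"
  let ?D = "l *\<^sub>R mat 1 :: real^'k^'k"
  let ?M = "\<lambda>T. principal_submatrix T A + principal_submatrix (- T) (mat 1)"
  have "(\<Prod>i\<in>UNIV. (?D - A) $ i $ p i) =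
      (\<Sum>T\<in>UNIV. (-1) ^ card T * ((\<Prod>i\<in>T. A $ i $ p i) * (\<Prod>i\<in>-T. ?D $ i $ p i)))" for p
    using prod_diff_conv_sum[of "UNIV :: 'k set" "\<lambda>i. ?D $ i $ p i" "\<lambda>i. A $ i $ p i"]
    by (simp add: Compl_eq_Diff_UNIV mult.assoc)
  then have "det (?D - A) = (\<Sum>p\<in>?P. \<Sum>T\<in>UNIV. of_int (sign p) * ((-1) ^ card T *
      ((\<Prod>i\<in>T. A $ i $ p i) * (\<Prod>i\<in>-T. ?D $ i $ p i))))"
    by (simp add: det_def sum_distrib_left)
  also have "\<dots> = (\<Sum>p\<in>?P. \<Sum>T\<in>UNIV. of_int (sign p) * ((-1) ^ card T *
      (l ^ card (- T) * (\<Prod>i\<in>UNIV. ?M T $ i $ p i))))"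
    by (intro sum.cong refl) (simp only: leibniz_term_principal_minor mem_Collect_eq)
  also have "\<dots> = (\<Sum>T\<in>UNIV. \<Sum>p\<in>?P. of_int (sign p) * ((-1) ^ card T *
      (l ^ card (- T) * (\<Prod>i\<in>UNIV. ?M T $ i $ p i))))"
    by (rule sum.swap)
  also have "\<dots> = (\<Sum>T\<in>UNIV. (-1) ^ card T * principal_minor T A * l ^ card (- T))"
    by (simp add: principal_minor_def det_def sum_distrib_left sum_distrib_right mult_ac)
  finally show ?thesis .
qed

lemma coeff_charpoly:
  fixes A :: "real^'k^'k"
  assumes "i \<le> CARD('k)"
  shows "coeff (charpoly A) i =
    (-1) ^ (CARD('k) - i) * (\<Sum>T | card T = CARD('k) - i. principal_minor T A)"
proof -
  have "charpoly A = (\<Sum>T\<in>UNIV. monom ((-1) ^ card T * principal_minor T A) (card (- T)))"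
    by (rule iffD1[OF poly_eq_poly_eq_iff])
       (simp add: fun_eq_iff poly_charpoly det_scaled_id_diff poly_sum poly_monom)
  then have "coeff (charpoly A) i =
      (\<Sum>T\<in>UNIV. if card (- T) = i then (-1) ^ card T * principal_minor T A else 0)"
    by (simp add: coeff_sum)
  also have "\<dots> = (\<Sum>T | card T = CARD('k) - i. (-1) ^ card T * principal_minor T A)"
  proof -
    have "card (- T) = i \<longleftrightarrow> card T = CARD('k) - i" for T :: "'k set"
      using assms card_mono[of UNIV T] by (auto simp: Compl_eq_Diff_UNIV card_Diff_subset)
    then show ?thesis by (simp add: sum.If_cases)
  qed
  finally show ?thesis by (simp add: sum_distrib_left)
qed

lemma abs_coeff_charpoly:
  fixes A :: "real^'k^'k"
  assumes "sym_pos_def A" and "i \<le> CARD('k)"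
  shows "\<bar>coeff (charpoly A) i\<bar> = (\<Sum>T | card T = CARD('k) - i. principal_minor T A)"
  using assms
  by (simp add: coeff_charpoly abs_mult power_abs sum_nonneg less_imp_le principal_minor_pos)

section \<open>The Kalman gain\<close>

lemma sym_pos_def_innovation_cov:
  fixes P :: "real^'n^'n" and R :: "real^'m^'m" and H :: "real^'n^'m"
  assumes "sym_pos_def P" and "sym_pos_def R"
  shows "sym_pos_def (H ** P ** transpose H + R)"
  using sym_pos_def_add[OF assms(2) sym_pos_semidef_congruence[OF sym_pos_def_imp_semidef],
      OF assms(1), of H]
  by (simp add: add.commute)

text \<open>If the quadratic form of \<open>P\<^sub>K\<close> vanishes at \<open>x\<close>, then \<open>K\<^sup>T x = 0\<close> because \<open>R\<close> is definite, and
  the first summand reduces to the form of \<open>P\<close> at \<open>x\<close>.\<close>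

lemma sym_pos_def_gain_cov:
  fixes P :: "real^'n^'n" and R :: "real^'m^'m" and H :: "real^'n^'m" and K :: "real^'m^'n"
  assumes P: "sym_pos_def P" and R: "sym_pos_def R"
  shows "sym_pos_def (gain_cov P R H K)"
  unfolding sym_pos_def_def
proof (intro conjI allI impI)
  let ?C = "mat 1 - K ** H"
  have psd: "sym_pos_semidef (?C ** P ** transpose ?C)" "sym_pos_semidef (K ** R ** transpose K)"
    by (intro sym_pos_semidef_congruence sym_pos_def_imp_semidef P R)+
  then show "transpose (gain_cov P R H K) = gain_cov P R H K"
    by (simp add: gain_cov_def transpose_add sym_pos_semidef_def)
  fix x :: "real^'n" assume x: "x \<noteq> 0"
  have eq: "x \<bullet> (gain_cov P R H K *v x) =
      x \<bullet> ((?C ** P ** transpose ?C) *v x) + x \<bullet> ((K ** R ** transpose K) *v x)"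
    by (simp add: gain_cov_def matrix_vector_mult_add_rdistrib inner_add_right)
  show "0 < x \<bullet> (gain_cov P R H K *v x)"
  proof (cases "transpose K *v x = 0")
    case True
    have "transpose ?C *v x = x - transpose H *v (transpose K *v x)"
      by (simp only: transpose_diff transpose_mat matrix_transpose_mul
          matrix_vector_mult_diff_rdistrib matrix_vector_mul_lid matrix_vector_mul_assoc)
    then have "transpose ?C *v x = x" using True by simp
    then have "0 < x \<bullet> ((?C ** P ** transpose ?C) *v x)"
      unfolding inner_congruence using P x by (simp add: sym_pos_def_def)
    then show ?thesis
      using psd(2) unfolding eq sym_pos_semidef_def by (auto intro!: add_pos_nonneg)
  next
    case False
    then have "0 < x \<bullet> ((K ** R ** transpose K) *v x)"
      unfolding inner_congruence using R unfolding sym_pos_def_def by blast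
    then show ?thesis
      using psd(1) unfolding eq sym_pos_semidef_def by (auto intro!: add_nonneg_pos)
  qed
qed

text \<open>Both sides are quadratic in the gain with the same leading term \<open>K S K\<^sup>T\<close>. The
  identity \<open>K\<^sub>* S = P H\<^sup>T\<close>, which is how \<open>K\<^sub>*\<close> is made, absorbs the terms linear in \<open>K\<close>.\<close>

lemma gain_cov_complete_square:
  fixes P :: "real^'n^'n" and R :: "real^'m^'m" and H :: "real^'n^'m" and K :: "real^'m^'n"
  assumes P: "sym_pos_def P" and R: "sym_pos_def R"
  defines "S \<equiv> H ** P ** transpose H + R" and "L \<equiv> kalman_gain P R H"
  shows "gain_cov P R H K = gain_cov P R H L + (K - L) ** S ** transpose (K - L)"
proof -
  have S: "sym_pos_def S"
    unfolding S_def by (rule sym_pos_def_innovation_cov[OF P R])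
  have symP: "transpose P = P" and symS: "transpose S = S"
    using P S by (simp_all add: sym_pos_def_def)
  have "matrix_inv S ** S = mat 1"
    using someI_ex[OF sym_pos_def_invertible[OF S, unfolded invertible_def]]
    by (simp add: matrix_inv_def)
  then have LS: "L ** S = P ** transpose H"
    unfolding L_def kalman_gain_def S_def[symmetric] by (simp flip: matrix_mul_assoc)
  have SL: "S ** transpose L = H ** P"
    using arg_cong[OF LS, of transpose] by (simp add: matrix_transpose_mul symP symS)
  have expand: "gain_cov P R H K =
      P - K ** H ** P - P ** transpose H ** transpose K + K ** S ** transpose K"
    for K :: "real^'m^'n"
    by (simp add: gain_cov_def S_def transpose_diff matrix_transpose_mul matrix_diff_ldistrib
        matrix_diff_rdistrib matrix_add_ldistrib matrix_add_rdistrib matrix_mul_assoc)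
  have "(K - L) ** S ** transpose (K - L) =
      K ** S ** transpose K - K ** (S ** transpose L) - L ** S ** transpose K
        + L ** S ** transpose L"
    by (simp add: transpose_diff matrix_diff_ldistrib matrix_diff_rdistrib matrix_mul_assoc)
  then have square: "(K - L) ** S ** transpose (K - L) =
      K ** S ** transpose K - K ** H ** P - P ** transpose H ** transpose K
        + P ** transpose H ** transpose L"
    by (simp only: SL LS matrix_mul_assoc)
  have "L ** H ** P = P ** transpose H ** transpose L"
    by (metis LS SL matrix_mul_assoc)
  then show ?thesis
    unfolding expand[of K] expand[of L] square by (simp add: LS)
qed

lemma abs_coeff_charpoly_gain_cov_minimal:
  fixes P :: "real^'n^'n" and R :: "real^'m^'m" and H :: "real^'n^'m" and K :: "real^'m^'n"
  assumes P: "sym_pos_def P" and R: "sym_pos_def R" and i: "i \<le> CARD('n)"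
  shows "\<bar>coeff (charpoly (gain_cov P R H (kalman_gain P R H))) i\<bar>
    \<le> \<bar>coeff (charpoly (gain_cov P R H K)) i\<bar>"
proof -
  have "principal_minor T (gain_cov P R H (kalman_gain P R H))
      \<le> principal_minor T (gain_cov P R H K)" for T
    by (subst gain_cov_complete_square[OF P R, of H K])
       (rule principal_minor_mono[OF sym_pos_def_gain_cov[OF P R] sym_pos_semidef_congruence[OF
            sym_pos_def_imp_semidef[OF sym_pos_def_innovation_cov[OF P R]]]])
  then show ?thesis
    unfolding abs_coeff_charpoly[OF sym_pos_def_gain_cov[OF P R] i] by (rule sum_mono)
qed

lemma differentiable_entry: "(\<lambda>K :: real^'m^'n. K $ i $ j) differentiable F"
  by (rule bounded_linear_imp_differentiable)
     (rule bounded_linear_compose[OF bounded_linear_vec_nth bounded_linear_vec_nth])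

lemma differentiable_prod:
  fixes f :: "'i \<Rightarrow> 'a::real_normed_vector \<Rightarrow> real"
  assumes "\<And>i. i \<in> I \<Longrightarrow> f i differentiable (at x)"
  shows "(\<lambda>x. \<Prod>i\<in>I. f i x) differentiable (at x)"
proof -
  have "(f i has_derivative frechet_derivative (f i) (at x)) (at x)" if "i \<in> I" for i
    using assms[OF that] by (rule iffD1[OF frechet_derivative_works])
  then have "((\<lambda>x. \<Prod>i\<in>I. f i x) has_derivative
      (\<lambda>y. \<Sum>i\<in>I. frechet_derivative (f i) (at x) y * (\<Prod>j\<in>I - {i}. f j x))) (at x)"
    by (rule has_derivative_prod)
  then show ?thesis
    by (rule differentiableI)
qed

lemma differentiable_principal_minor_gain_cov:
  fixes P :: "real^'n^'n" and R :: "real^'m^'m" and H :: "real^'n^'m" and K :: "real^'m^'n"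
  shows "(\<lambda>K. principal_minor T (gain_cov P R H K)) differentiable (at K)"
proof -
  have entry: "(\<lambda>K. gain_cov P R H K $ a $ b) differentiable (at K)" for a b
    unfolding gain_cov_def matrix_matrix_mult_def transpose_def mat_def
    by (simp del: differentiable_cmult_left_iff differentiable_cmult_right_iff
        add: differentiable_entry)
  have "(\<lambda>K. (principal_submatrix T (gain_cov P R H K) + principal_submatrix (- T) (mat 1)) $ a $ b)
      differentiable (at K)" for a b
    by (cases "a \<in> T"; cases "b \<in> T") (simp_all add: principal_submatrix_def entry)
  then show ?thesis
    unfolding principal_minor_def det_def
    by (intro differentiable_sum ballI differentiable_mult differentiable_const differentiable_prod)
       auto
qed

theorem corollary1p2:
  fixes P :: "real^'n^'n" and R :: "real^'m^'m" and H :: "real^'n^'m"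
  assumes "sym_pos_def P" and "sym_pos_def R"
  shows "(\<forall>i\<in>{1..CARD('n)}.
            critical_point (\<lambda>K. \<bar>coeff (charpoly (gain_cov P R H K)) i\<bar>) (kalman_gain P R H))
       \<and> (\<forall>i\<in>{0..CARD('n)}. even i \<longrightarrow>
            (\<forall>K. \<bar>coeff (charpoly (gain_cov P R H (kalman_gain P R H))) i\<bar>
                 \<le> \<bar>coeff (charpoly (gain_cov P R H K)) i\<bar>))"
proof (intro conjI ballI impI allI)
  fix i K assume "i \<in> {0..CARD('n)}"
  then show "\<bar>coeff (charpoly (gain_cov P R H (kalman_gain P R H))) i\<bar>
      \<le> \<bar>coeff (charpoly (gain_cov P R H K)) i\<bar>"
    by (intro abs_coeff_charpoly_gain_cov_minimal assms) auto
next
  fix i assume "i \<in> {1..CARD('n)}"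
  then have i: "i \<le> CARD('n)" by simp
  let ?f = "\<lambda>K. \<bar>coeff (charpoly (gain_cov P R H K)) i\<bar>"
  let ?L = "kalman_gain P R H"
  have "?f differentiable (at ?L)"
    unfolding abs_coeff_charpoly[OF sym_pos_def_gain_cov[OF assms] i]
    by (intro differentiable_sum ballI differentiable_principal_minor_gain_cov) simp
  then obtain f' where f': "(?f has_derivative f') (at ?L)"
    by (auto simp: differentiable_def)
  then have "f' = (\<lambda>_. 0)"
    by (rule differential_zero_maxmin[of _ UNIV, rotated 2])
       (auto intro!: abs_coeff_charpoly_gain_cov_minimal assms i)
  with f' show "critical_point ?f ?L" by (simp add: critical_point_def)
qed

end
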